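(* Let $\mathbf d=(2,m,k)$ with $m\ge2$ and $k\ge1$, and let $\sigma(x)=1/x$. Then the neurovariety $\mathcal V_{\mathbf d,\sigma}(\mathbb C)$ is filling, i.e. $\mathcal V_{\mathbf d,\sigma}(\mathbb C)=(S^{m-1}(\mathbb C^2))^k\times S^m(\mathbb C^2)$, but the neuromanifold $\mathcal M_{\mathbf d,\sigma}(\mathbb C)$ is not filling, i.e. $\mathcal M_{\mathbf d,\sigma}(\mathbb C)\subsetneq(S^{m-1}(\mathbb C^2))^k\times S^m(\mathbb C^2)$.
   Context: $S^d(\mathbb C^n)$ is the space of complex homogeneous polynomials of degree $d$ in $n$ variables. For architecture $\mathbf d=(n,m,k)$ and complex weights $\mathbf w=(W_1,W_2)$, $W_1\in\mathbb C^{m\times n}$, $W_2=(b_{ij})\in\mathbb C^{k\times m}$, put $\ell_j=(W_1\mathbf x)_j$ and $\hat\ell_{j,m}=\prod_{s\ne j}\ell_s$, and $$P_{i,\mathbf w}=\sum_{j=1}^m b_{ij}\hat\ell_{j,m}\ (1\le i\le k),\qquad Q_{\mathbf w}=\ell_1\cdots\ell_m.$$ These are the numerators and the common denominator of the network $f_{\mathbf w}=W_2\circ\sigma\circ W_1$. The neuromanifold $\mathcal M_{\mathbf d,\sigma}(\mathbb C)$ is the set of all tuples $(P_{1,\mathbf w},\dots,P_{k,\mathbf w},Q_{\mathbf w})\in(S^{m-1}(\mathbb C^n))^k\times S^m(\mathbb C^n)$ as $\mathbf w$ ranges over all complex weights, and the neurovariety $\mathcal V_{\mathbf d,\sigma}(\mathbb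 C)$ is its Zariski closure. *)

theory Defs
  imports
    Complex_Main
    "HOL-Library.FuncSet"
    "HOL-Library.Poly_Mapping"
    "HOL-Computational_Algebra.Fraction_Field"
    "Jordan_Normal_Form.Matrix"
begin

text \<open>
  A complex polynomial is a finitely supported map from monomials to coefficients, and a monomial
  is a finitely supported map from variable indices to exponents; the ring structure is the
  convolution product of \<^theory>\<open>HOL-Library.Poly_Mapping\<close>. All indices start at 0, so the
  variables of a polynomial on \<open>\<complex>\<^sup>n\<close> are those with index below \<open>n\<close>.
\<close>

type_synonym monomial = "nat \<Rightarrow>\<^sub>0 nat"
type_synonym cpoly = "monomial \<Rightarrow>\<^sub>0 complex"

definition Const :: "complex \<Rightarrow> cpoly" where
  "Const c = Poly_Mapping.single 0 c"

definition Var :: "nat \<Rightarrow> cpoly" where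
  "Var t = Poly_Mapping.single (Poly_Mapping.single t 1) 1"

text \<open>The space \<open>S\<^sup>d(\<complex>\<^sup>n)\<close>; like every such space it contains the zero polynomial.\<close>

definition forms :: "nat \<Rightarrow> nat \<Rightarrow> cpoly set" where
  "forms d n = {p. \<forall>\<mu>\<in>Poly_Mapping.keys p. Poly_Mapping.keys \<mu> \<subseteq> {..<n} \<and>
                      (\<Sum>t\<in>Poly_Mapping.keys \<mu>. Poly_Mapping.lookup \<mu> t) = d}"

text \<open>
  \<open>(S\<^sup>m\<^sup>-\<^sup>1(\<complex>\<^sup>n))\<^sup>k \<times> S\<^sup>m(\<complex>\<^sup>n)\<close>; a \<open>k\<close>-tuple is an extensional function on \<open>{..<k}\<close>.
\<close>

type_synonym point = "(nat \<Rightarrow> cpoly) \<times> cpoly"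

definition ambient :: "nat \<Rightarrow> nat \<Rightarrow> nat \<Rightarrow> point set" where
  "ambient n m k = ({..<k} \<rightarrow>\<^sub>E forms (m - 1) n) \<times> forms m n"


section \<open>The neuromanifold\<close>

definition lin :: "complex mat \<Rightarrow> nat \<Rightarrow> cpoly" where
  "lin W1 j = (map_mat Const W1 *\<^sub>v vec (dim_col W1) Var) $ j"

definition lin_hat :: "complex mat \<Rightarrow> nat \<Rightarrow> cpoly" where
  "lin_hat W1 j = (\<Prod>s\<in>{..<dim_row W1} - {j}. lin W1 s)"

definition numer :: "complex mat \<Rightarrow> complex mat \<Rightarrow> nat \<Rightarrow> cpoly" where
  "numer W1 W2 i = (\<Sum>j<dim_row W1. Const (W2 $$ (i, j)) * lin_hat W1 j)"

definition denom :: "complex mat \<Rightarrow> cpoly" where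
  "denom W1 = (\<Prod>j<dim_row W1. lin W1 j)"

definition neuromanifold :: "nat \<Rightarrow> nat \<Rightarrow> nat \<Rightarrow> point set" where
  "neuromanifold n m k =
     {(restrict (numer W1 W2) {..<k}, denom W1) | W1 W2.
        W1 \<in> carrier_mat m n \<and> W2 \<in> carrier_mat k m}"

text \<open>
  The activation \<open>\<sigma>(x) = 1/x\<close> enters only through this identity of rational functions: the
  \<open>i\<close>-th output of \<open>W2 \<circ> \<sigma> \<circ> W1\<close> is the quotient of \<^const>\<open>numer\<close> by \<^const>\<open>denom\<close>.
\<close>

lemma network_eq_numer_denom:
  assumes "\<And>j. j < dim_row W1 \<Longrightarrow> lin W1 j \<noteq> 0"
  shows "(\<Sum>j<dim_row W1. Fraction_Field.Fract (Const (W2 $$ (i, j))) 1 * (1 / Fraction_Field.Fract (lin W1 j) 1))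
         = Fraction_Field.Fract (numer W1 W2 i) (denom W1)"
proof -
  have nz: "denom W1 \<noteq> 0"
    using assms by (simp add: denom_def)
  have sum: "Fraction_Field.Fract (\<Sum>j\<in>A. f j) (denom W1) = (\<Sum>j\<in>A. Fraction_Field.Fract (f j) (denom W1))"
    if "finite A" for A :: "nat set" and f
    using that
  proof (induction A)
    case empty
    then show ?case by (simp add: Zero_fract_def eq_fract nz)
  next
    case (insert x A)
    then show ?case by (simp add: eq_fract nz algebra_simps flip: insert.IH)
  qed
  have "Fraction_Field.Fract (Const (W2 $$ (i, j))) 1 * (1 / Fraction_Field.Fract (lin W1 j) 1)
        = Fraction_Field.Fract (Const (W2 $$ (i, j)) * lin_hat W1 j) (denom W1)" if "j < dim_row W1" for j
  proof -
    have "denom W1 = lin W1 j * lin_hat W1 j"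
      unfolding denom_def lin_hat_def using that by (intro prod.remove) auto
    then show ?thesis
      using nz assms[OF that] by (simp add: One_fract_def eq_fract)
  qed
  then show ?thesis
    by (simp add: numer_def sum)
qed


section \<open>Zariski closure and the neurovariety\<close>

text \<open>
  The coordinates on the ambient space are the coefficients of the component polynomials; the
  polynomial functions are the complex algebra they generate.
\<close>

inductive_set polynomial_functions :: "nat \<Rightarrow> (point \<Rightarrow> complex) set" for k :: nat where
  const: "(\<lambda>_. c) \<in> polynomial_functions k"
| coeff_P: "i < k \<Longrightarrow> (\<lambda>(P, Q). Poly_Mapping.lookup (P i) \<mu>) \<in> polynomial_functions k"
| coeff_Q: "(\<lambda>(P, Q). Poly_Mapping.lookup Q \<mu>) \<in> polynomial_functions k"
| add: "f \<in> polynomial_functions k \<Longrightarrow> g \<in> polynomial_functions k \<Longrightarrow>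
          (\<lambda>v. f v + g v) \<in> polynomial_functions k"
| mult: "f \<in> polynomial_functions k \<Longrightarrow> g \<in> polynomial_functions k \<Longrightarrow>
          (\<lambda>v. f v * g v) \<in> polynomial_functions k"

definition zariski_closed :: "nat \<Rightarrow> nat \<Rightarrow> nat \<Rightarrow> point set \<Rightarrow> bool" where
  "zariski_closed n m k Z \<longleftrightarrow>
     (\<exists>F \<subseteq> polynomial_functions k. Z = {v \<in> ambient n m k. \<forall>f\<in>F. f v = 0})"

definition neurovariety :: "nat \<Rightarrow> nat \<Rightarrow> nat \<Rightarrow> point set" where
  "neurovariety n m k = zariski_closed n m k hull neuromanifold n m k"

end

theory Submission
  imports Defs "HOL-Computational_Algebra.Fundamental_Theorem_Algebra"
begin

text \<open>
  Write the linear forms of the first layer as \<open>\<ell>\<^sub>j = a\<^sub>j x + b\<^sub>j y\<close>, with \<open>x, y\<close> the variables 0 and 1.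

  The neurovariety is everything. Suppose that the \<open>m\<close> forms \<open>\<ell>\<^sub>j\<close> are pairwise non-proportional and
  that every \<open>a\<^sub>j\<close> is nonzero. Then the \<open>m\<close> products obtained from \<open>\<ell>\<^sub>1 \<cdots> \<ell>\<^sub>m\<close> by leaving out one
  factor are, up to scalars, the Lagrange basis of \<open>S\<^sup>m\<^sup>-\<^sup>1(\<complex>\<^sup>2)\<close> for the zeros of the \<open>\<ell>\<^sub>j\<close>. Hence every
  tuple \<open>P\<close> is a tuple of numerators over the denominator \<open>Q = \<ell>\<^sub>1 \<cdots> \<ell>\<^sub>m\<close>
  (\<open>distinct_factors_in_neuromanifold\<close>). For an arbitrary target \<open>(P, Q)\<close>, the fundamental theorem
  of algebra still writes \<open>Q\<close> as a product of linear forms (\<open>binary_form_splits\<close>), possibly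
  with repeated or zero factors. These factors are moved along the lines
  \<open>(1 - t) \<ell>\<^sub>j + t (x - j y)\<close>. At \<open>t = 1\<close> they satisfy the genericity condition, which is the
  nonvanishing of a polynomial in \<open>t\<close>, so they satisfy it for all but finitely many \<open>t\<close>. A polynomial
  function that vanishes on the neuromanifold restricts to a polynomial in \<open>t\<close> on the curve
  \<open>t \<mapsto> (P, Q\<^sub>t)\<close> (\<open>polynomial_function_along_curve\<close>); this polynomial vanishes at almost all \<open>t\<close>,
  hence also at \<open>t = 0\<close>, which is the target.

  The neuromanifold is not everything. If \<open>\<ell>\<^sub>1 \<cdots> \<ell>\<^sub>m = x\<^sup>m\<close>, then every \<open>\<ell>\<^sub>j\<close> is a multiple of \<open>x\<close>,
  so that every numerator is a multiple of \<open>x\<^sup>m\<^sup>-\<^sup>1\<close>. Since \<open>m \<ge> 2\<close>, the numerator \<open>y\<^sup>m\<^sup>-\<^sup>1\<close> cannot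
  occur over the denominator \<open>x\<^sup>m\<close>.
\<close>

section \<open>Evaluation of polynomials in two variables\<close>

lemma Const_0 [simp]: "Const 0 = 0"
  and Const_1 [simp]: "Const 1 = 1"
  and Const_add: "Const (c + d) = Const c + Const d"
  and Const_mult: "Const (c * d) = Const c * Const d"
  by (simp_all add: Const_def single_add mult_single)

lemma cpoly_expansion:
  fixes p :: cpoly
  shows "p = (\<Sum>\<mu>\<in>Poly_Mapping.keys p. Poly_Mapping.single \<mu> (Poly_Mapping.lookup p \<mu>))"
  by (rule poly_mapping_eqI)
     (simp add: lookup_sum lookup_single when_def in_keys_iff)

lemma lookup_Const_mult: "Poly_Mapping.lookup (Const c * p) \<mu> = c * Poly_Mapping.lookup p \<mu>"
proof -
  have "Const c * p = (\<Sum>\<nu>\<in>Poly_Mapping.keys p. Poly_Mapping.single \<nu> (c * Poly_Mapping.lookup p \<nu>))"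
    by (subst cpoly_expansion[of p]) (simp add: sum_distrib_left Const_def mult_single)
  then show ?thesis
    by (simp add: lookup_sum lookup_single when_def in_keys_iff)
qed

text \<open>
  Only the variables with indices 0 and 1 are substituted: any other variable is sent to 1, so that
  evaluation is a ring homomorphism on all of \<^typ>\<open>cpoly\<close>.
\<close>

definition eval2 :: "complex \<Rightarrow> complex \<Rightarrow> cpoly \<Rightarrow> complex" where
  "eval2 x y p = (\<Sum>\<mu>\<in>Poly_Mapping.keys p.
     Poly_Mapping.lookup p \<mu> * (x ^ Poly_Mapping.lookup \<mu> 0 * y ^ Poly_Mapping.lookup \<mu> 1))"

lemma eval2_superset:
  assumes "finite A" "Poly_Mapping.keys p \<subseteq> A"
  shows "eval2 x y p = (\<Sum>\<mu>\<in>A.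
     Poly_Mapping.lookup p \<mu> * (x ^ Poly_Mapping.lookup \<mu> 0 * y ^ Poly_Mapping.lookup \<mu> 1))"
  unfolding eval2_def using assms
  by (intro sum.mono_neutral_left) (auto simp: in_keys_iff)

lemma eval2_single:
  "eval2 x y (Poly_Mapping.single \<mu> c) = c * (x ^ Poly_Mapping.lookup \<mu> 0 * y ^ Poly_Mapping.lookup \<mu> 1)"
  by (simp add: eval2_def)

lemma eval2_0 [simp]: "eval2 x y 0 = 0"
  by (simp add: eval2_def)

lemma eval2_add [simp]: "eval2 x y (p + q) = eval2 x y p + eval2 x y q"
proof -
  let ?A = "Poly_Mapping.keys p \<union> Poly_Mapping.keys q"
  have "Poly_Mapping.keys (p + q) \<subseteq> ?A"
    by (rule keys_add)
  then show ?thesis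
    by (simp add: eval2_superset[of ?A] lookup_add ring_distribs sum.distrib)
qed

lemma eval2_sum [simp]: "eval2 x y (\<Sum>i\<in>I. f i) = (\<Sum>i\<in>I. eval2 x y (f i))"
  by (induction I rule: infinite_finite_induct) simp_all

lemma eval2_diff [simp]: "eval2 x y (p - q) = eval2 x y p - eval2 x y q"
  using eval2_add[of x y "p - q" q] by (simp del: eval2_add)

lemma eval2_mult [simp]: "eval2 x y (p * q) = eval2 x y p * eval2 x y q"
proof -
  have "p * q = (\<Sum>\<mu>\<in>Poly_Mapping.keys p. \<Sum>\<nu>\<in>Poly_Mapping.keys q.
      Poly_Mapping.single (\<mu> + \<nu>) (Poly_Mapping.lookup p \<mu> * Poly_Mapping.lookup q \<nu>))"
    by (subst cpoly_expansion[of p], subst cpoly_expansion[of q]) (simp add: sum_product mult_single)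
  also have "eval2 x y \<dots> = eval2 x y p * eval2 x y q"
    unfolding eval2_def[of x y p] eval2_def[of x y q] sum_product
    by (simp add: eval2_single lookup_add power_add mult_ac)
  finally show ?thesis .
qed

lemma eval2_Const [simp]: "eval2 x y (Const c) = c"
  by (simp add: Const_def eval2_single)

lemma eval2_1 [simp]: "eval2 x y 1 = 1"
  using eval2_Const[of x y 1] by simp

lemma eval2_prod [simp]: "eval2 x y (\<Prod>i\<in>I. f i) = (\<Prod>i\<in>I. eval2 x y (f i))"
  by (induction I rule: infinite_finite_induct) simp_all

lemma eval2_power [simp]: "eval2 x y (p ^ n) = eval2 x y p ^ n"
  by (induction n) simp_all

lemma eval2_Var [simp]:
  "eval2 x y (Var 0) = x" "eval2 x y (Var 1) = y" "eval2 x y (Var (Suc 0)) = y"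
  by (simp_all add: Var_def eval2_single lookup_single)


section \<open>Forms\<close>

text \<open>
  Summing exponents over all admissible variables, instead of over the support of the monomial,
  makes the degree visibly additive.
\<close>

lemma forms_altdef:
  "forms d n = {p. \<forall>\<mu>\<in>Poly_Mapping.keys p. Poly_Mapping.keys \<mu> \<subseteq> {..<n} \<and>
                     (\<Sum>t<n. Poly_Mapping.lookup \<mu> t) = d}"
proof -
  have "(\<Sum>t\<in>Poly_Mapping.keys \<mu>. Poly_Mapping.lookup \<mu> t) = (\<Sum>t<n. Poly_Mapping.lookup \<mu> t)"
    if "Poly_Mapping.keys \<mu> \<subseteq> {..<n}" for \<mu> :: monomial
    using that by (intro sum.mono_neutral_left) (auto simp: in_keys_iff)
  then show ?thesis
    unfolding forms_def by (intro Collect_cong ball_cong refl) (auto cong: conj_cong)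
qed

lemma forms_0: "0 \<in> forms d n"
  by (simp add: forms_def)

lemma forms_add: "p \<in> forms d n \<Longrightarrow> q \<in> forms d n \<Longrightarrow> p + q \<in> forms d n"
  using keys_add[of p q] unfolding forms_def by blast

lemma forms_diff: "p \<in> forms d n \<Longrightarrow> q \<in> forms d n \<Longrightarrow> p - q \<in> forms d n"
  using keys_diff[of p q] unfolding forms_def by blast

lemma forms_sum: "(\<And>i. i \<in> I \<Longrightarrow> f i \<in> forms d n) \<Longrightarrow> (\<Sum>i\<in>I. f i) \<in> forms d n"
  by (induction I rule: infinite_finite_induct) (auto intro: forms_0 forms_add)

lemma forms_mult:
  assumes "p \<in> forms d n" "q \<in> forms e n"
  shows "p * q \<in> forms (d + e) n"
proof -
  have "Poly_Mapping.keys \<mu> \<subseteq> {..<n} \<and> (\<Sum>t<n. Poly_Mapping.lookup \<mu> t) = d + e"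
    if "\<mu> \<in> Poly_Mapping.keys (p * q)" for \<mu>
  proof -
    obtain \<alpha> \<beta> where "\<alpha> \<in> Poly_Mapping.keys p" "\<beta> \<in> Poly_Mapping.keys q" "\<mu> = \<alpha> + \<beta>"
      using \<open>\<mu> \<in> Poly_Mapping.keys (p * q)\<close> keys_mult[of p q] by blast
    moreover from this have "Poly_Mapping.keys \<alpha> \<union> Poly_Mapping.keys \<beta> \<subseteq> {..<n}"
      using assms unfolding forms_altdef by blast
    ultimately show ?thesis
      using assms keys_add[of \<alpha> \<beta>] unfolding forms_altdef
      by (simp add: lookup_add sum.distrib) blast
  qed
  then show ?thesis
    unfolding forms_altdef by blast
qed

lemma forms_Const: "Const c \<in> forms 0 n"
  by (simp add: forms_def Const_def)

lemma forms_Const_mult: "p \<in> forms d n \<Longrightarrow> Const c * p \<in> forms d n"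
  using forms_mult[OF forms_Const, of p d n c] by simp

lemma forms_Var: "t < n \<Longrightarrow> Var t \<in> forms 1 n"
  by (simp add: forms_def Var_def)

lemma forms_prod:
  assumes "finite I" "\<And>i. i \<in> I \<Longrightarrow> f i \<in> forms 1 n"
  shows "(\<Prod>i\<in>I. f i) \<in> forms (card I) n"
  using assms
proof (induction I)
  case empty
  then show ?case
    using forms_Const[of 1 n] by simp
next
  case (insert i I)
  then show ?case
    using forms_mult[of "f i" 1 n "prod f I" "card I"] by simp
qed

lemma forms_Var_power: "t < n \<Longrightarrow> Var t ^ d \<in> forms d n"
  using forms_prod[of "{..<d}" "\<lambda>_. Var t" n] forms_Var by simp

text \<open>
  Setting \<open>y = 1\<close> loses no information on binary forms of a fixed degree, because a monomial of
  degree \<open>d\<close> in \<open>x, y\<close> is determined by its exponent of \<open>x\<close>.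
\<close>

definition dehomogenize :: "cpoly \<Rightarrow> complex poly" where
  "dehomogenize p =
     (\<Sum>\<mu>\<in>Poly_Mapping.keys p. Polynomial.monom (Poly_Mapping.lookup p \<mu>) (Poly_Mapping.lookup \<mu> 0))"

lemma poly_dehomogenize: "poly (dehomogenize p) r = eval2 r 1 p"
  by (simp add: dehomogenize_def eval2_def poly_sum poly_monom)

lemma binary_degree:
  assumes "p \<in> forms d 2" "\<mu> \<in> Poly_Mapping.keys p"
  shows "Poly_Mapping.lookup \<mu> 0 + Poly_Mapping.lookup \<mu> 1 = d"
proof -
  have "(\<Sum>t<2. Poly_Mapping.lookup \<mu> t) = d"
    using assms unfolding forms_altdef by blast
  then show ?thesis
    by (simp add: eval_nat_numeral)
qed

lemma degree_dehomogenize: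
  assumes "p \<in> forms d 2"
  shows "degree (dehomogenize p) \<le> d"
  unfolding dehomogenize_def
proof (rule degree_sum_le)
  fix \<mu> assume "\<mu> \<in> Poly_Mapping.keys p"
  then have "Poly_Mapping.lookup \<mu> 0 \<le> d"
    using binary_degree[OF assms] by fastforce
  then show "degree (Polynomial.monom (Poly_Mapping.lookup p \<mu>) (Poly_Mapping.lookup \<mu> 0)) \<le> d"
    using degree_monom_le order_trans by blast
qed simp

lemma dehomogenize_eq_0D:
  assumes "p \<in> forms d 2" "dehomogenize p = 0"
  shows "p = 0"
proof (rule ccontr)
  assume "p \<noteq> 0"
  then obtain \<mu> where \<mu>: "\<mu> \<in> Poly_Mapping.keys p"
    by (metis keys_eq_empty ex_in_conv poly_mapping_eqI lookup_zero in_keys_iff)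
  have unique: "\<nu> = \<mu>"
    if "\<nu> \<in> Poly_Mapping.keys p" "Poly_Mapping.lookup \<nu> 0 = Poly_Mapping.lookup \<mu> 0" for \<nu>
  proof (rule poly_mapping_eqI)
    fix t
    have small: "Poly_Mapping.keys \<nu> \<subseteq> {..<2}" "Poly_Mapping.keys \<mu> \<subseteq> {..<2}"
      using that \<mu> assms(1) unfolding forms_altdef by blast+
    have "Poly_Mapping.lookup \<nu> 1 = Poly_Mapping.lookup \<mu> 1"
      using binary_degree[OF assms(1) that(1)] binary_degree[OF assms(1) \<mu>] that(2) by simp
    moreover have "Poly_Mapping.lookup \<nu> t = 0" "Poly_Mapping.lookup \<mu> t = 0" if "t \<ge> 2"
      using small that by (auto simp: subset_iff in_keys_iff)
    ultimately show "Poly_Mapping.lookup \<nu> t = Poly_Mapping.lookup \<mu> t"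
      using that(2) by (metis less_2_cases not_less One_nat_def)
  qed
  have "coeff (dehomogenize p) (Poly_Mapping.lookup \<mu> 0)
        = (\<Sum>\<nu>\<in>Poly_Mapping.keys p. if \<nu> = \<mu> then Poly_Mapping.lookup p \<nu> else 0)"
    unfolding dehomogenize_def coeff_sum using unique by (intro sum.cong) auto
  also have "\<dots> = Poly_Mapping.lookup p \<mu>"
    using \<mu> by simp
  finally show False
    using \<mu> assms(2) by (simp add: in_keys_iff)
qed

lemma binary_form_eqI:
  assumes "p \<in> forms d 2" "q \<in> forms d 2"
    and "card A > d" "\<And>r. r \<in> A \<Longrightarrow> eval2 r 1 p = eval2 r 1 q"
  shows "p = q"
proof -
  have form: "p - q \<in> forms d 2"
    using assms(1,2) by (rule forms_diff)
  have "dehomogenize (p - q) = 0"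
    using degree_dehomogenize[OF form] assms(3,4)
    by (intro poly_eqI_degree[of A]) (auto simp: poly_dehomogenize)
  then show ?thesis
    using dehomogenize_eq_0D[OF form] by simp
qed


section \<open>Linear forms in two variables and networks\<close>

definition lin_form :: "complex \<Rightarrow> complex \<Rightarrow> cpoly" where
  "lin_form a b = Const a * Var 0 + Const b * Var 1"

lemma eval2_lin_form [simp]: "eval2 x y (lin_form a b) = a * x + b * y"
  by (simp add: lin_form_def)

lemma lin_form_in_forms: "lin_form a b \<in> forms 1 2"
  unfolding lin_form_def by (intro forms_add forms_Const_mult forms_Var) auto

lemma lin_eq_lin_form:
  assumes "W1 \<in> carrier_mat m 2" "j < m"
  shows "lin W1 j = lin_form (W1 $$ (j, 0)) (W1 $$ (j, 1))"
  using assms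
  by (simp add: lin_def lin_form_def scalar_prod_def eval_nat_numeral row_def)

lemma lin_hat_in_forms:
  assumes "W1 \<in> carrier_mat m 2" "j < m"
  shows "lin_hat W1 j \<in> forms (m - 1) 2"
proof -
  have "(\<Prod>s\<in>{..<m} - {j}. lin W1 s) \<in> forms (card ({..<m} - {j})) 2"
    using assms(1) by (intro forms_prod) (auto simp: lin_eq_lin_form[OF assms(1)] lin_form_in_forms simp del: One_nat_def)
  then show ?thesis
    using assms by (simp add: lin_hat_def)
qed

lemma numer_in_forms:
  assumes "W1 \<in> carrier_mat m 2"
  shows "numer W1 W2 i \<in> forms (m - 1) 2"
  using assms unfolding numer_def
  by (intro forms_sum forms_Const_mult lin_hat_in_forms) auto

lemma denom_in_forms:
  assumes "W1 \<in> carrier_mat m 2"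
  shows "denom W1 \<in> forms m 2"
  using assms forms_prod[of "{..<m}" "lin W1" 2]
  by (simp add: denom_def lin_eq_lin_form[OF assms] lin_form_in_forms del: One_nat_def)

lemma neuromanifold_subset_ambient: "neuromanifold 2 m k \<subseteq> ambient 2 m k"
proof
  fix v assume "v \<in> neuromanifold 2 m k"
  then obtain W1 W2 where "v = (restrict (numer W1 W2) {..<k}, denom W1)" "W1 \<in> carrier_mat m 2"
    unfolding neuromanifold_def by blast
  then show "v \<in> ambient 2 m k"
    unfolding ambient_def using numer_in_forms denom_in_forms by simp
qed


section \<open>Generic denominators\<close>

text \<open>
  The form \<open>a\<^sub>j x + b\<^sub>j y\<close> vanishes at \<open>(r\<^sub>j, 1)\<close> with \<open>r\<^sub>j = - b\<^sub>j / a\<^sub>j\<close>, and these points are distinct.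
  At \<open>(r\<^sub>j, 1)\<close> every product with one factor left out is zero, except the one that omits the factor
  \<open>j\<close>. So the output weights can be read off as interpolation coefficients, and two forms of degree
  \<open>m - 1\<close> that agree at these \<open>m\<close> points are equal.
\<close>

lemma distinct_factors_in_neuromanifold:
  assumes P: "P \<in> {..<k} \<rightarrow>\<^sub>E forms (m - 1) 2" and "m \<ge> 1"
    and a: "\<And>j. j < m \<Longrightarrow> a j \<noteq> 0"
    and ab: "\<And>i j. i < j \<Longrightarrow> j < m \<Longrightarrow> a i * b j \<noteq> a j * b i"
  shows "(P, \<Prod>j<m. lin_form (a j) (b j)) \<in> neuromanifold 2 m k"
proof -
  define W1 where "W1 = mat m 2 (\<lambda>(j, c). if c = 0 then a j else b j)"
  define r where "r j = - b j / a j" for j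
  define W2 where "W2 = mat k m (\<lambda>(i, j). eval2 (r j) 1 (P i) / eval2 (r j) 1 (lin_hat W1 j))"
  have W1: "W1 \<in> carrier_mat m 2" and W2: "W2 \<in> carrier_mat k m"
    by (simp_all add: W1_def W2_def)
  have lin: "lin W1 j = lin_form (a j) (b j)" if "j < m" for j
    using lin_eq_lin_form[OF W1 that] that by (simp add: W1_def)
  have root: "a i * r j + b i = 0 \<longleftrightarrow> i = j" if "i < m" "j < m" for i j
  proof
    assume "a i * r j + b i = 0"
    then have "a i * b j = a j * b i"
      using a[OF that(2)] by (simp add: r_def field_simps)
    then show "i = j"
      using ab[of i j] ab[of j i] that by (metis linorder_neqE_nat)
  next
    assume "i = j"
    then show "a i * r j + b i = 0"
      using a[OF that(2)] by (simp add: r_def)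
  qed
  have hat_nonzero: "eval2 (r j) 1 (lin_hat W1 j) \<noteq> 0" if "j < m" for j
    using that W1 root by (auto simp: lin_hat_def lin)
  have hat_zero: "eval2 (r i) 1 (lin_hat W1 j) = 0" if "i < m" "j < m" "i \<noteq> j" for i j
    using that W1 root by (auto simp: lin_hat_def lin)
  have numer: "numer W1 W2 i = P i" if "i < k" for i
  proof (rule binary_form_eqI)
    show "numer W1 W2 i \<in> forms (m - 1) 2"
      by (rule numer_in_forms[OF W1])
    show "P i \<in> forms (m - 1) 2"
      using P that by auto
    have "inj_on r {..<m}"
      using root by (metis inj_onI lessThan_iff)
    then show "card (r ` {..<m}) > m - 1"
      using \<open>m \<ge> 1\<close> by (simp add: card_image)
    fix z assume "z \<in> r ` {..<m}"
    then obtain s where s: "s < m" "z = r s"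
      by auto
    have "eval2 z 1 (numer W1 W2 i)
          = (\<Sum>j<m. W2 $$ (i, j) * eval2 (r s) 1 (lin_hat W1 j))"
      using W1 s by (simp add: numer_def)
    also have "\<dots> = (\<Sum>j<m. if j = s then W2 $$ (i, s) * eval2 (r s) 1 (lin_hat W1 s) else 0)"
      using s hat_zero by (intro sum.cong) auto
    also have "\<dots> = eval2 z 1 (P i)"
      using s that hat_nonzero by (simp add: W2_def)
    finally show "eval2 z 1 (numer W1 W2 i) = eval2 z 1 (P i)" .
  qed
  have "restrict (numer W1 W2) {..<k} = P"
    using P numer by (auto simp: fun_eq_iff PiE_def extensional_def restrict_def)
  moreover have "denom W1 = (\<Prod>j<m. lin_form (a j) (b j))"
    using W1 by (simp add: denom_def lin)
  ultimately show ?thesis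
    unfolding neuromanifold_def using W1 W2 by (metis (mono_tags, lifting) mem_Collect_eq)
qed


section \<open>Factorization of binary forms\<close>

text \<open>
  A polynomial of degree below \<open>m\<close> is padded with constant factors 1, which homogenize to \<open>y\<close>; the
  leading constant is absorbed in a factor, which needs \<open>m \<ge> 1\<close>.
\<close>

lemma poly_splits_padded:
  fixes p :: "complex poly"
  assumes "m \<ge> 1" "degree p \<le> m"
  shows "\<exists>a b. \<forall>r. poly p r = (\<Prod>j<m. a j * r + b j)"
  using assms
proof (induction m arbitrary: p rule: nat_induct_at_least)
  case base
  then have "poly p r = poly [:coeff p 0, coeff p 1:] r" for r
    by (intro arg_cong2[of _ _ _ _ poly] poly_eqI)
       (auto simp: coeff_pCons coeff_eq_0 split: nat.split)
  then show ?case
    by (intro exI[of _ "\<lambda>_. coeff p 1"] exI[of _ "\<lambda>_. coeff p 0"]) (simp add: algebra_simps)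
next
  case (Suc m)
  obtain q c d where q: "degree q \<le> m" "\<And>r. poly p r = poly q r * (c * r + d)"
  proof (cases "degree p \<le> m")
    case True
    then show ?thesis
      using that[of p 0 1] by simp
  next
    case False
    then have "\<not> constant (poly p)"
      by (simp add: constant_degree)
    then obtain z where "poly p z = 0"
      using fundamental_theorem_of_algebra by blast
    then obtain q where p: "p = [:- z, 1:] * q"
      unfolding poly_eq_0_iff_dvd by (elim dvdE)
    with False have "q \<noteq> 0"
      by auto
    then have "degree p = Suc (degree q)"
      unfolding p by (subst degree_mult_eq) auto
    moreover have "poly p r = poly q r * (1 * r + - z)" for r
      unfolding p by (simp add: algebra_simps)
    ultimately show ?thesis
      using that[of q 1 "- z"] Suc.prems by simp
  qed
  obtain a b where "\<And>r. poly q r = (\<Prod>j<m. a j * r + b j)"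
    using Suc.IH[OF q(1)] by blast
  then show ?case
    using q(2) by (intro exI[of _ "a(m := c)"] exI[of _ "b(m := d)"]) simp
qed

lemma binary_form_splits:
  assumes "m \<ge> 1" "Q \<in> forms m 2"
  obtains a b where "Q = (\<Prod>j<m. lin_form (a j) (b j))"
proof -
  obtain a b where ab: "\<And>r. poly (dehomogenize Q) r = (\<Prod>j<m. a j * r + b j)"
    using poly_splits_padded[OF assms(1) degree_dehomogenize[OF assms(2)]] by blast
  have "Q = (\<Prod>j<m. lin_form (a j) (b j))"
  proof (rule binary_form_eqI[OF assms(2)])
    show "(\<Prod>j<m. lin_form (a j) (b j)) \<in> forms m 2"
      using forms_prod[of "{..<m}" "\<lambda>j. lin_form (a j) (b j)" 2] lin_form_in_forms by simp
    show "card (of_nat ` {..m} :: complex set) > m"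
      by (subst card_image) (auto simp: inj_on_def)
  qed (use ab in \<open>simp add: poly_dehomogenize\<close>)
  then show thesis ..
qed


section \<open>Density of the neuromanifold\<close>

text \<open>
  A polynomial curve of forms is encoded as a polynomial \<open>G\<close> with coefficients in \<^typ>\<open>cpoly\<close>,
  evaluated at constants; the ring structure of such \<open>G\<close> makes a product of curves a curve.
\<close>

lemma lookup_along_curve:
  "Poly_Mapping.lookup (poly G (Const t)) \<mu> = poly (map_poly (\<lambda>q. Poly_Mapping.lookup q \<mu>) G) t"
  by (induction G) (simp_all add: map_poly_pCons lookup_add lookup_Const_mult)

lemma polynomial_function_along_curve:
  assumes "f \<in> polynomial_functions k"
  shows "\<exists>p. \<forall>t. f (P, poly G (Const t)) = poly p t"
  using assms
proof induction
  case (const c)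
  show ?case by (intro exI[of _ "[:c:]"]) simp
next
  case (coeff_P i \<mu>)
  show ?case by (intro exI[of _ "[:Poly_Mapping.lookup (P i) \<mu>:]"]) simp
next
  case (coeff_Q \<mu>)
  show ?case by (auto simp: lookup_along_curve)
next
  case (add f g)
  then obtain p q where "\<forall>t. f (P, poly G (Const t)) = poly p t" "\<forall>t. g (P, poly G (Const t)) = poly q t"
    by blast
  then show ?case by (intro exI[of _ "p + q"]) simp
next
  case (mult f g)
  then obtain p q where "\<forall>t. f (P, poly G (Const t)) = poly p t" "\<forall>t. g (P, poly G (Const t)) = poly q t"
    by blast
  then show ?case by (intro exI[of _ "p * q"]) simp
qed

lemma vanishing_on_neuromanifold:
  assumes "m \<ge> 1" and f: "f \<in> polynomial_functions k"
    and vanish: "\<And>v. v \<in> neuromanifold 2 m k \<Longrightarrow> f v = 0"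
    and "v \<in> ambient 2 m k"
  shows "f v = 0"
proof -
  obtain P Q where v: "v = (P, Q)" and P: "P \<in> {..<k} \<rightarrow>\<^sub>E forms (m - 1) 2" and Q: "Q \<in> forms m 2"
    using assms(4) by (auto simp: ambient_def)
  obtain a b where ab: "Q = (\<Prod>j<m. lin_form (a j) (b j))"
    using binary_form_splits[OF \<open>m \<ge> 1\<close> Q] .
  \<comment> \<open>The curve of factors \<open>(1 - t) \<ell>\<^sub>j + t (x - j y)\<close>.\<close>
  define A where "A j = [:a j, 1 - a j:]" for j
  define B where "B j = [:b j, - of_nat j - b j:]" for j
  define L where "L j = [:Const (a j), Const (1 - a j):] * [:Var 0:]
    + [:Const (b j), Const (- of_nat j - b j):] * [:Var 1:]" for j
  define G where "G = (\<Prod>j<m. L j)"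
  have "poly (L j) (Const t) = lin_form (poly (A j) t) (poly (B j) t)" for j t
    unfolding L_def A_def B_def lin_form_def
    by (simp add: Const_add Const_mult distrib_left distrib_right mult_ac add_ac)
  then have G: "poly G (Const t) = (\<Prod>j<m. lin_form (poly (A j) t) (poly (B j) t))" for t
    by (simp add: G_def poly_prod)
  \<comment> \<open>The parameters at which the factors fail to be generic are the zeros of \<open>D\<close>.\<close>
  define D where "D = (\<Prod>j<m. A j * (\<Prod>i<j. A i * B j - A j * B i))"
  have "poly (A j) 1 = 1" "poly (B j) 1 = - of_nat j" for j
    by (simp_all add: A_def B_def)
  then have "poly D 1 \<noteq> 0"
    by (simp add: D_def poly_prod)
  then have "D \<noteq> 0"
    by auto
  obtain p where p: "\<And>t. f (P, poly G (Const t)) = poly p t"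
    using polynomial_function_along_curve[OF f] by blast
  have "poly (p * D) t = 0" for t
  proof (cases "poly D t = 0")
    case False
    then have "poly (A j) t \<noteq> 0" if "j < m" for j
      using that by (auto simp: D_def poly_prod)
    moreover have "poly (A i) t * poly (B j) t \<noteq> poly (A j) t * poly (B i) t" if "i < j" "j < m" for i j
      using that False by (auto simp: D_def poly_prod)
    ultimately have "(P, poly G (Const t)) \<in> neuromanifold 2 m k"
      unfolding G by (intro distinct_factors_in_neuromanifold P \<open>m \<ge> 1\<close>)
    then have "poly p t = 0"
      using vanish p by metis
    then show ?thesis
      by simp
  qed simp
  then have "p * D = 0"
    using poly_all_0_iff_0 by blast
  then have "f (P, poly G (Const 0)) = 0"
    using \<open>D \<noteq> 0\<close> p[of 0] by simp
  then show ?thesis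
    unfolding G v ab by (simp add: A_def B_def)
qed

lemma neurovariety_filling:
  assumes "m \<ge> 1"
  shows "neurovariety 2 m k = ambient 2 m k"
proof
  have "ambient 2 m k = {v \<in> ambient 2 m k. \<forall>f\<in>{}. f v = 0}"
    by simp
  then have "zariski_closed 2 m k (ambient 2 m k)"
    unfolding zariski_closed_def by blast
  then show "neurovariety 2 m k \<subseteq> ambient 2 m k"
    unfolding neurovariety_def using neuromanifold_subset_ambient by (intro hull_minimal)
  show "ambient 2 m k \<subseteq> neurovariety 2 m k"
  proof
    fix v assume v: "v \<in> ambient 2 m k"
    have "v \<in> Z" if "neuromanifold 2 m k \<subseteq> Z" and Z: "zariski_closed 2 m k Z" for Z
    proof -
      obtain F where F: "F \<subseteq> polynomial_functions k" "Z = {v \<in> ambient 2 m k. \<forall>f\<in>F. f v = 0}"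
        using Z unfolding zariski_closed_def by blast
      have "f v = 0" if "f \<in> F" for f
        using vanishing_on_neuromanifold[OF assms _ _ v, of f] that F \<open>neuromanifold 2 m k \<subseteq> Z\<close> by blast
      then show ?thesis
        using F v by blast
    qed
    then show "v \<in> neurovariety 2 m k"
      unfolding neurovariety_def hull_def by blast
  qed
qed


section \<open>A point outside the neuromanifold\<close>

text \<open>
  Evaluating at \<open>(1, 0)\<close> shows that no factor \<open>a\<^sub>j x + b\<^sub>j y\<close> has \<open>a\<^sub>j = 0\<close>. The factor vanishes at \<open>(b\<^sub>j, - a\<^sub>j)\<close>,
  where \<open>x\<^sup>m\<close> takes the value \<open>b\<^sub>j\<^sup>m\<close>; hence \<open>b\<^sub>j = 0\<close>.
\<close>

lemma factor_of_Var_power: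
  assumes "(\<Prod>j<m. lin_form (a j) (b j)) = Var 0 ^ m" "j < m"
  shows "b j = 0"
proof -
  have "eval2 (b j) (- a j) (\<Prod>j<m. lin_form (a j) (b j)) = 0"
    using assms(2) by (auto simp: mult.commute)
  then show ?thesis
    using assms(1) by simp
qed

lemma not_in_neuromanifold:
  assumes "m \<ge> 2" "k \<ge> 1"
  shows "(restrict (\<lambda>_. Var 1 ^ (m - 1)) {..<k}, Var 0 ^ m) \<notin> neuromanifold 2 m k"
proof
  assume "(restrict (\<lambda>_. Var 1 ^ (m - 1)) {..<k}, Var 0 ^ m) \<in> neuromanifold 2 m k"
  then obtain W1 W2 where W1: "W1 \<in> carrier_mat m 2"
    and eq: "restrict (numer W1 W2) {..<k} = restrict (\<lambda>_. Var 1 ^ (m - 1)) {..<k}"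
    and Q: "denom W1 = Var 0 ^ m"
    by (auto simp: neuromanifold_def)
  have P: "numer W1 W2 0 = Var 1 ^ (m - 1)"
    using fun_cong[OF eq, of 0] \<open>k \<ge> 1\<close> by simp
  have "(\<Prod>j<m. lin_form (W1 $$ (j, 0)) (W1 $$ (j, 1))) = Var 0 ^ m"
    using Q W1 by (simp add: denom_def lin_eq_lin_form)
  then have b: "W1 $$ (j, 1) = 0" if "j < m" for j
    using factor_of_Var_power[of "\<lambda>j. W1 $$ (j, 0)" "\<lambda>j. W1 $$ (j, 1)" m j] that by blast
  have lin: "eval2 0 1 (lin W1 j) = 0" if "j < m" for j
    using lin_eq_lin_form[OF W1 that] b[OF that] by simp
  have "eval2 0 1 (lin_hat W1 j) = 0" if "j < m" for j
  proof -
    \<comment> \<open>Here \<open>m \<ge> 2\<close> enters: leaving out one factor must not empty the product.\<close>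
    obtain s where "s \<in> {..<m} - {j}"
      using \<open>m \<ge> 2\<close> by (cases "j = 0") (auto intro: that[of 0] that[of 1])
    then show ?thesis
      using W1 lin[of s] by (auto simp: lin_hat_def intro!: prod_zero bexI[of _ s])
  qed
  then have "eval2 0 1 (numer W1 W2 0) = 0"
    using W1 by (simp add: numer_def)
  then show False
    by (simp add: P)
qed

theorem proposition4p4:
  fixes m k :: nat
  assumes "m \<ge> 2" and "k \<ge> 1"
  shows "neurovariety 2 m k = ambient 2 m k \<and> neuromanifold 2 m k \<subset> ambient 2 m k"
proof
  show "neurovariety 2 m k = ambient 2 m k"
    using assms by (intro neurovariety_filling) simp
  have "(restrict (\<lambda>_. Var 1 ^ (m - 1)) {..<k}, Var 0 ^ m) \<in> ambient 2 m k"
    by (auto simp: ambient_def intro: forms_Var_power)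
  then show "neuromanifold 2 m k \<subset> ambient 2 m k"
    using not_in_neuromanifold[OF assms] neuromanifold_subset_ambient by blast
qed

end
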